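(* Let $\varphi_1$ be a Jacob's ladder, let $k_0\in\mathbb{N}$ be fixed, let $1\le k\le k_0$, and let $\Delta>0$ be fixed. For each $L\in\mathbb{N}$ let $a_L\in(0,\frac12]$. Then there is $\bar L_0>0$ such that for all $L\in\mathbb{N}$ with $L>\bar L_0$ and all $U\in(0,a_L)$ the $\mathcal{Z}_{\zeta,Q^2}$-transformation of the function $f(t)=(t-L)^\Delta$, $t\in[L,L+U]$, is $\frac{1}{\Delta+1}\left(\frac{U}{\alpha_0-L}\right)^\Delta$. That is, for all points $\alpha_0,\alpha_1,\dots,\alpha_k$ associated with $(L,U,k;f)$ and all points $\beta_1,\dots,\beta_k$ associated with $(L,U,k)$ (so that $\alpha_0\in(L,L+U)$) one has $$\prod_{r=1}^k\left|\frac{\zeta\left(\frac12+i\alpha_r\right)}{\zeta\left(\frac12+i\beta_r\right)}\right|^2=\left\{1+\mathcal{O}\left(\frac{\ln\ln L}{\ln L}\right)\right\}\frac{1}{\Delta+1}\left(\frac{U}{\alpha_0-L}\right)^\Delta,\qquad L\to\infty,$$ uniformly in $U\in(0,a_L)$, where the implied constant may depend on $\Delta$, $k_0$ and $\varphi_1$.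
   Context: $\zeta$ is the Riemann zeta-function and $Z(t)=e^{i\vartheta(t)}\zeta(\frac12+it)$ is Hardy's function, so $|Z(t)|=|\zeta(\frac12+it)|$. Jacob's ladder. Let $\mu$ be an admissible function: $\mu\in C^\infty([y_0,\infty))$ is increasing, unbounded, and $\mu(y)\ge 7y\ln y$. Let $y=\varphi(T)=\varphi(T;\mu)$ be the solution $x(T)=\varphi(T)$ of the nonlinear integral equation $$\int_0^{\mu[x(T)]}Z^2(t)e^{-\frac{2}{x(T)}t}\,dt=\int_0^TZ^2(t)\,dt .$$ The Jacob's ladder is $\varphi_1(t)=\frac12\varphi(t)$. For large $t$ it is a continuously differentiable strictly increasing function tending to infinity, with $t-\varphi_1(t)\sim(1-c)\frac{t}{\ln t}$ ($c$ is Euler's constant). Its derivative is denoted $\tilde Z^2(t)=\frac{d\varphi_1(t)}{dt}$ and satisfies $$\tilde Z^2(t)=\frac{|\zeta(\frac12+it)|^2}{\left\{1+\mathcal{O}\left(\frac{\ln\ln t}{\ln t}\right)\right\}\ln t},\qquad t\to\infty .$$ These are known properties of $\varphi_1$. Iterates. $\varphi_1^0(t)=t$, $\varphi_1^r=\varphi_1\circ\varphi_1^{r-1}$. For large $T$ and $r=0,1,\dots,k_0$, the reverse iterates are $\overset{r}{T}=\varphi_1^{-r}(T)$, i.e. $\overset{0}{T}=T$ and $\varphi_1(\overset{r}{T})=\overset{r-1}{T}$; similarly $(T+U)^{[r]}:=\varphi_1^{-r}(T+U)$. Associated points. Let $f$ be continuous on $[T,T+U]$, $U>0$. By the change of variables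 $t\mapsto\varphi_1^k(t)$ and the mean-value theorem there is $d\in(\overset{k}{T},(T+U)^{[k]})$ with $$\int_T^{T+U}f(t)\,dt=\int_{\overset{k}{T}}^{(T+U)^{[k]}}f[\varphi_1^k(t)]\prod_{r=0}^{k-1}\tilde Z^2[\varphi_1^r(t)]\,dt=\left((T+U)^{[k]}-\overset{k}{T}\right)f(\alpha_0)\prod_{r=1}^k\tilde Z^2(\alpha_r),$$ where $\alpha_r=\varphi_1^{k-r}(d)$, $r=0,1,\dots,k$. Any $\alpha_0,\dots,\alpha_k$ obtained from such a $d$ are called the points associated with $(T,U,k;f)$; one has $\alpha_0\in(T,T+U)$ and $\alpha_r\in(\overset{r}{T},(T+U)^{[r]})$. Points $\beta_1,\dots,\beta_k$ are associated with $(T,U,k)$ if they arise in the same way from $f\equiv1$: $\beta_r=\varphi_1^{k-r}(e)$, $r=1,\dots,k$, for some $e\in(\overset{k}{T},(T+U)^{[k]})$ with $U=\left((T+U)^{[k]}-\overset{k}{T}\right)\prod_{r=1}^k\tilde Z^2(\beta_r)$. In the claim these are used with $T=L$. The $\mathcal{Z}_{\zeta,Q^2}$-transformation. The $\mathcal{Z}_{\zeta,Q^2}$-transformation of $f(t)$, $t\in[T,T+U]$, $U\in(0,U_0)$, is said to be $g=g[T,U,\alpha_0(T,U,k;f)]$, $U\in(0,U_0)$, $\alpha_0\in(T,T+U)$, if $$\prod_{r=1}^k\left|\frac{\zeta(\frac12+i\alpha_r)}{\zeta(\frac12+i\beta_r)}\right|^2=\left\{1+\mathcal{O}\left(\frac{\ln\ln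 T}{\ln T}\right)\right\}g,\qquad T\to\infty .$$ *)

theory Defs
  imports "HOL-Complex_Analysis.Complex_Analysis" "HOL-Library.Landau_Symbols"
begin

section \<open>The zeta function and Hardy's function\<close>

text \<open>
  The Riemann zeta function is the analytic continuation of the Dirichlet series to the plane
  without the point 1. The value at the pole is fixed to 0 only to make the description unique.
\<close>

definition riemann_zeta :: "complex \<Rightarrow> complex" where
  "riemann_zeta = (THE f. f holomorphic_on (- {1}) \<and> f 1 = 0 \<and>
     (\<forall>s. Re s > 1 \<longrightarrow> (\<lambda>n. 1 / of_nat (Suc n) powr s) sums f s))"

abbreviation zeta_crit :: "real \<Rightarrow> complex" where
  "zeta_crit t \<equiv> riemann_zeta (1/2 + \<i> * complex_of_real t)"

text \<open>
  On the half-plane of positive real part, \<^const>\<open>ln_Gamma\<close> is the holomorphic branch of the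
  logarithm of the Gamma function which is real on the positive real axis.
\<close>

definition hardy_theta :: "real \<Rightarrow> real" where
  "hardy_theta t = Im (ln_Gamma (1/4 + \<i> * complex_of_real (t/2))) - t/2 * ln pi"

text \<open>
  By the functional equation the number inside \<^const>\<open>Re\<close> is real; taking the real part only
  turns it into an object of type \<^typ>\<open>real\<close>.
\<close>

definition hardy_Z :: "real \<Rightarrow> real" where
  "hardy_Z t = Re (exp (\<i> * complex_of_real (hardy_theta t)) * zeta_crit t)"


section \<open>Jacob's ladders\<close>

text \<open>Infinite differentiability on a closed half-line, one-sided at the end point.\<close>

definition smooth_on_half_line :: "real \<Rightarrow> (real \<Rightarrow> real) \<Rightarrow> bool" where
  "smooth_on_half_line y0 \<mu> \<longleftrightarrow>
     (\<exists>D :: nat \<Rightarrow> real \<Rightarrow> real. (\<forall>y\<ge>y0. D 0 y = \<mu> y) \<and>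
        (\<forall>n. \<forall>y\<ge>y0. (D n has_real_derivative D (Suc n) y) (at y within {y0..})))"

definition admissible :: "real \<Rightarrow> (real \<Rightarrow> real) \<Rightarrow> bool" where
  "admissible y0 \<mu> \<longleftrightarrow>
     y0 > 0 \<and> smooth_on_half_line y0 \<mu> \<and> mono_on {y0..} \<mu> \<and>
     \<not> bdd_above (\<mu> ` {y0..}) \<and> (\<forall>y\<ge>y0. \<mu> y \<ge> 7 * y * ln y)"

text \<open>
  The ladder lives on a half-line of large arguments, here the open half-line to the right of
  \<open>T0\<close>; values of the total function \<open>\<phi>1\<close> outside of it carry no meaning.
\<close>

definition jacobs_ladder :: "real \<Rightarrow> (real \<Rightarrow> real) \<Rightarrow> real \<Rightarrow> (real \<Rightarrow> real) \<Rightarrow> bool" where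
  "jacobs_ladder y0 \<mu> T0 \<phi>1 \<longleftrightarrow>
     (\<exists>\<phi> :: real \<Rightarrow> real.
        (\<forall>T>T0. \<phi> T \<ge> y0 \<and>
           integral {0..\<mu> (\<phi> T)} (\<lambda>t. (hardy_Z t)\<^sup>2 * exp (- (2 / \<phi> T) * t)) =
           integral {0..T} (\<lambda>t. (hardy_Z t)\<^sup>2)) \<and>
        (\<forall>T>T0. \<phi>1 T = \<phi> T / 2))"

text \<open>
  Reverse iterates: the inverse is that of \<open>\<phi>1\<close> on its half-line. When \<open>\<phi>1\<close> is continuous and
  strictly increasing to infinity there, with \<open>\<phi>1 t < t\<close> for large \<open>t\<close>, every large \<open>T\<close> has
  genuine reverse iterates of all orders.
\<close>

definition rev_iterate :: "real \<Rightarrow> (real \<Rightarrow> real) \<Rightarrow> nat \<Rightarrow> real \<Rightarrow> real" where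
  "rev_iterate T0 \<phi>1 r = (inv_into {T0<..} \<phi>1) ^^ r"


section \<open>Associated points and the transformation\<close>

text \<open>
  Point systems are sequences of which only the entries \<open>0, \<dots>, k\<close>, respectively \<open>1, \<dots>, k\<close>,
  are constrained. The function written as Z-tilde squared is \<open>deriv \<phi>1\<close>.
\<close>

definition associated_points ::
  "real \<Rightarrow> (real \<Rightarrow> real) \<Rightarrow> real \<Rightarrow> real \<Rightarrow> nat \<Rightarrow> (real \<Rightarrow> real) \<Rightarrow> (nat \<Rightarrow> real) \<Rightarrow> bool" where
  "associated_points T0 \<phi>1 T U k f \<alpha> \<longleftrightarrow>
     (\<exists>d \<in> {rev_iterate T0 \<phi>1 k T <..< rev_iterate T0 \<phi>1 k (T + U)}.
        (\<forall>r\<in>{0..k}. \<alpha> r = (\<phi>1 ^^ (k - r)) d) \<and>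
        integral {T..T + U} f =
          (rev_iterate T0 \<phi>1 k (T + U) - rev_iterate T0 \<phi>1 k T) * f (\<alpha> 0) *
          (\<Prod>r=1..k. deriv \<phi>1 (\<alpha> r)))"

definition associated_points_one ::
  "real \<Rightarrow> (real \<Rightarrow> real) \<Rightarrow> real \<Rightarrow> real \<Rightarrow> nat \<Rightarrow> (nat \<Rightarrow> real) \<Rightarrow> bool" where
  "associated_points_one T0 \<phi>1 T U k \<beta> \<longleftrightarrow>
     (\<exists>e \<in> {rev_iterate T0 \<phi>1 k T <..< rev_iterate T0 \<phi>1 k (T + U)}.
        (\<forall>r\<in>{1..k}. \<beta> r = (\<phi>1 ^^ (k - r)) e) \<and>
        U = (rev_iterate T0 \<phi>1 k (T + U) - rev_iterate T0 \<phi>1 k T) *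
            (\<Prod>r=1..k. deriv \<phi>1 (\<beta> r)))"

text \<open>
  The transformation of \<open>f\<close> on \<open>[T, T + U]\<close>, \<open>U \<in> (0, U0)\<close>, is \<open>g U \<alpha>0\<close>, with \<open>C\<close> as the constant
  in the error term. The asymptotic notion as \<open>T\<close> tends to infinity is obtained by asking for
  this at all large \<open>T\<close> with \<open>C\<close> independent of \<open>T\<close>.
\<close>

definition ZQ2_transformation ::
  "real \<Rightarrow> real \<Rightarrow> (real \<Rightarrow> real) \<Rightarrow> nat \<Rightarrow> real \<Rightarrow> real \<Rightarrow> (real \<Rightarrow> real) \<Rightarrow>
   (real \<Rightarrow> real \<Rightarrow> real) \<Rightarrow> bool" where
  "ZQ2_transformation C T0 \<phi>1 k T U0 f g \<longleftrightarrow>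
     (\<forall>U\<in>{0<..<U0}. \<forall>\<alpha> \<beta>.
        associated_points T0 \<phi>1 T U k f \<alpha> \<longrightarrow> associated_points_one T0 \<phi>1 T U k \<beta> \<longrightarrow>
        \<alpha> 0 \<in> {T<..<T + U} \<and>
        (\<exists>\<theta>::real. \<bar>\<theta>\<bar> \<le> C * (ln (ln T) / ln T) \<and>
           (\<Prod>r=1..k. (cmod (zeta_crit (\<alpha> r) / zeta_crit (\<beta> r)))\<^sup>2) = (1 + \<theta>) * g U (\<alpha> 0)))"

end

theory Submission
  imports Defs "HOL-Real_Asymp.Real_Asymp"
begin

text \<open>
  Dividing the mean-value identity for \<open>f t = (t - L) powr \<Delta>\<close> by the one for the constant 1
  cancels the length of the interval between the reverse iterates and leaves
  \<open>(\<Prod>r=1..k. deriv \<phi>1 (\<alpha> r) / deriv \<phi>1 (\<beta> r)) = 1 / (\<Delta> + 1) * (U / (\<alpha> 0 - L)) powr \<Delta>\<close>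
  with no error term (\<open>mean_value_quotient\<close>). The error comes only from replacing the derivative of
  the ladder by \<open>\<bar>\<zeta>(1/2 + it)\<bar>\<^sup>2\<close>: every \<open>r\<close> contributes a factor
  \<open>(1 + \<epsilon> (\<alpha> r)) * ln (\<alpha> r) / ((1 + \<epsilon> (\<beta> r)) * ln (\<beta> r))\<close>.

  The perturbations \<open>\<epsilon>\<close> are \<open>O(ln ln L / ln L)\<close> because all points lie to the right of \<open>L\<close> and
  \<open>ln ln t / ln t\<close> decreases for large \<open>t\<close>. The logarithms are compared in a crude way: since
  \<open>t - \<phi>1 t\<close> is positive and \<open>o(t)\<close>, one has \<open>t / 2 \<le> \<phi>1 t < t\<close> for large \<open>t\<close>, so each
  application of the inverse increases its argument at most by the factor 2
  (\<open>rev_iterate_bounds\<close>). Hence \<open>\<alpha> r\<close> and \<open>\<beta> r\<close> lie in \<open>[L, 2 ^ (k0 + 1) L]\<close>, and their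
  logarithms differ by a bounded amount, which is a relative error of \<open>O(1 / ln L)\<close>. A product of at most \<open>k0\<close> such factors is again
  \<open>1 + O(ln ln L / ln L)\<close> (\<open>abs_prod_minus_1_le\<close>).
\<close>

section \<open>Reverse iterates of a function close to the identity\<close>

text \<open>
  The upper bound \<open>\<phi> t < t\<close> on \<open>[X, \<infinity>)\<close> gives \<open>\<phi> X < X\<close>, so the intermediate value theorem
  reaches every \<open>s \<ge> X\<close> from a point of \<open>[X, \<infinity>)\<close>; there the two bounds on \<open>\<phi>\<close> apply.
\<close>

lemma inv_into_half_line:
  fixes \<phi> :: "real \<Rightarrow> real"
  assumes cont: "continuous_on {T0<..} \<phi>" and mono: "strict_mono_on {T0<..} \<phi>"
    and lim: "filterlim \<phi> at_top at_top"
    and X: "X > T0" and bounds: "\<And>t. t \<ge> X \<Longrightarrow> t / 2 \<le> \<phi> t \<and> \<phi> t < t"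
    and s: "s \<ge> X"
  shows "\<phi> (inv_into {T0<..} \<phi> s) = s" "s < inv_into {T0<..} \<phi> s"
    "inv_into {T0<..} \<phi> s \<le> 2 * s"
proof -
  obtain b where b: "b \<ge> X" "\<phi> b \<ge> s"
    using eventually_conj[OF lim[unfolded filterlim_at_top, rule_format, of s]
        eventually_ge_at_top[of X]]
    by (auto simp: eventually_at_top_linorder)
  have "\<phi> X \<le> s" using bounds[of X] s by simp
  moreover have "continuous_on {X..b} \<phi>"
    by (rule continuous_on_subset[OF cont]) (use X in auto)
  ultimately obtain t where t: "X \<le> t" "t \<le> b" "\<phi> t = s"
    using IVT'[of \<phi> X s b] b by auto
  have "inv_into {T0<..} \<phi> s = t"
    using inv_into_f_f[OF strict_mono_on_imp_inj_on[OF mono], of t] t X by auto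
  then show "\<phi> (inv_into {T0<..} \<phi> s) = s" "s < inv_into {T0<..} \<phi> s"
    "inv_into {T0<..} \<phi> s \<le> 2 * s"
    using bounds[of t] t by auto
qed

lemma rev_iterate_bounds:
  fixes \<phi> :: "real \<Rightarrow> real"
  assumes cont: "continuous_on {T0<..} \<phi>" and mono: "strict_mono_on {T0<..} \<phi>"
    and lim: "filterlim \<phi> at_top at_top"
    and X: "X > T0" "X \<ge> 0" and bounds: "\<And>t. t \<ge> X \<Longrightarrow> t / 2 \<le> \<phi> t \<and> \<phi> t < t"
    and s: "s \<ge> X"
  shows "s \<le> rev_iterate T0 \<phi> r s" "rev_iterate T0 \<phi> r s \<le> 2 ^ r * s"
    "\<phi> (rev_iterate T0 \<phi> (Suc r) s) = rev_iterate T0 \<phi> r s"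
proof -
  note inv = inv_into_half_line[OF cont mono lim X(1) bounds]
  have *: "s \<le> rev_iterate T0 \<phi> r s \<and> rev_iterate T0 \<phi> r s \<le> 2 ^ r * s" for r
  proof (induction r)
    case (Suc r)
    show ?case
      using inv[of "rev_iterate T0 \<phi> r s"] Suc s by (auto simp: rev_iterate_def)
  qed (simp add: rev_iterate_def)
  show "s \<le> rev_iterate T0 \<phi> r s" "rev_iterate T0 \<phi> r s \<le> 2 ^ r * s" using * by auto
  have "rev_iterate T0 \<phi> r s \<ge> X" using *[of r] s by simp
  then show "\<phi> (rev_iterate T0 \<phi> (Suc r) s) = rev_iterate T0 \<phi> r s"
    using inv(1)[of "rev_iterate T0 \<phi> r s"] by (simp add: rev_iterate_def)
qed

text \<open>
  Each application of the increasing function \<open>\<phi>\<close> removes one reverse iterate from both end points.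
\<close>

lemma funpow_between_rev_iterates:
  fixes \<phi> :: "real \<Rightarrow> real"
  assumes cont: "continuous_on {T0<..} \<phi>" and mono: "strict_mono_on {T0<..} \<phi>"
    and lim: "filterlim \<phi> at_top at_top"
    and X: "X > T0" "X \<ge> 0" and bounds: "\<And>t. t \<ge> X \<Longrightarrow> t / 2 \<le> \<phi> t \<and> \<phi> t < t"
    and s: "s \<ge> X" "s' \<ge> X"
    and d: "d \<in> {rev_iterate T0 \<phi> k s <..< rev_iterate T0 \<phi> k s'}" and j: "j \<le> k"
  shows "(\<phi> ^^ j) d \<in> {rev_iterate T0 \<phi> (k - j) s <..< rev_iterate T0 \<phi> (k - j) s'}"
  using j
proof (induction j)
  case 0
  then show ?case using d by simp
next
  case (Suc j)
  note rev = rev_iterate_bounds[OF cont mono lim X bounds]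
  obtain m where m: "k - j = Suc m" "k - Suc j = m" using Suc.prems
    by (metis Suc_diff_Suc Suc_le_lessD)
  have IH: "rev_iterate T0 \<phi> (Suc m) s < (\<phi> ^^ j) d"
    "(\<phi> ^^ j) d < rev_iterate T0 \<phi> (Suc m) s'"
    using Suc by (simp_all add: m)
  have "T0 < rev_iterate T0 \<phi> (Suc m) s" using rev(1)[OF _ s(1), of "Suc m"] s X by simp
  then have "\<phi> (rev_iterate T0 \<phi> (Suc m) s) < \<phi> ((\<phi> ^^ j) d)"
    "\<phi> ((\<phi> ^^ j) d) < \<phi> (rev_iterate T0 \<phi> (Suc m) s')"
    using IH by (auto intro!: strict_mono_onD[OF mono])
  then show ?case using rev(3)[OF _ s(1), of m] rev(3)[OF _ s(2), of m] by (simp add: m)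
qed

lemma funpow_bounds:
  fixes \<phi> :: "real \<Rightarrow> real"
  assumes cont: "continuous_on {T0<..} \<phi>" and mono: "strict_mono_on {T0<..} \<phi>"
    and lim: "filterlim \<phi> at_top at_top"
    and X: "X > T0" "X \<ge> 0" and bounds: "\<And>t. t \<ge> X \<Longrightarrow> t / 2 \<le> \<phi> t \<and> \<phi> t < t"
    and s: "s \<ge> X" "s' \<ge> X"
    and d: "d \<in> {rev_iterate T0 \<phi> k s <..< rev_iterate T0 \<phi> k s'}" and j: "j \<le> k"
  shows "s \<le> (\<phi> ^^ j) d" "(\<phi> ^^ j) d \<le> 2 ^ k * s'"
proof -
  note between = funpow_between_rev_iterates[OF cont mono lim X bounds s d j, simplified]
  note rev = rev_iterate_bounds[OF cont mono lim X bounds]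
  show "s \<le> (\<phi> ^^ j) d" using between rev(1)[OF _ s(1), of "k - j"] by simp
  have "(\<phi> ^^ j) d \<le> 2 ^ (k - j) * s'" using between rev(2)[OF _ s(2), of "k - j"] by simp
  also have "\<dots> \<le> 2 ^ k * s'" using s X by (intro mult_right_mono power_increasing) auto
  finally show "(\<phi> ^^ j) d \<le> 2 ^ k * s'" .
qed

lemma eventually_between_half_and_self:
  fixes \<phi> :: "real \<Rightarrow> real"
  assumes asymp: "(\<lambda>t. t - \<phi> t) \<sim>[at_top] (\<lambda>t. (1 - euler_mascheroni) * t / ln t)"
  shows "\<forall>\<^sub>F t in at_top. t / 2 \<le> \<phi> t \<and> \<phi> t < t"
proof -
  have c: "(1 - euler_mascheroni :: real) > 0" using euler_mascheroni_less_13_over_22 by simp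
  have "\<forall>\<^sub>F t in at_top. (1 - euler_mascheroni) * t / ln t > (0::real)"
    using eventually_gt_at_top[of 1] by eventually_elim (use c in auto)
  then have pos: "\<forall>\<^sub>F t in at_top. t - \<phi> t > 0"
    using asymp_equiv_eventually_pos_iff[OF asymp] by (auto elim: eventually_elim2)
  have "(\<lambda>t. t - \<phi> t) \<in> O[at_top](\<lambda>t. (1 - euler_mascheroni) * t / ln t)"
    using asymp by (rule asymp_equiv_imp_bigo)
  moreover have "(\<lambda>t::real. (1 - euler_mascheroni) * t / ln t) \<in> o[at_top](\<lambda>t. t)"
    by real_asymp
  ultimately have "(\<lambda>t. t - \<phi> t) \<in> o[at_top](\<lambda>t. t)"
    by (rule landau_o.big_small_trans)
  from landau_o.smallD[OF this, of "1/2"]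
  have "\<forall>\<^sub>F t in at_top. norm (t - \<phi> t) \<le> 1/2 * norm t" by simp
  with pos eventually_gt_at_top[of 0] show ?thesis
    by eventually_elim auto
qed


section \<open>Factors close to 1\<close>

lemma abs_prod_minus_1_le:
  fixes F :: "nat \<Rightarrow> real"
  assumes F: "\<And>r. r \<in> A \<Longrightarrow> \<bar>F r - 1\<bar> \<le> \<delta>" and small: "real (card A) * \<delta> \<le> 1" and \<delta>: "\<delta> \<ge> 0"
  shows "\<bar>(\<Prod>r\<in>A. F r) - 1\<bar> \<le> 2 * real (card A) * \<delta>"
proof -
  have "\<bar>(\<Prod>r\<in>A. F r) - 1\<bar> = norm ((\<Prod>r\<in>A. 1 + (F r - 1)) - 1)" by simp
  also have "\<dots> \<le> (\<Prod>r\<in>A. 1 + norm (F r - 1)) - 1"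
    by (rule norm_prod_minus1_le_prod_minus1)
  also have "\<dots> \<le> (\<Prod>r\<in>A. 1 + \<delta>) - 1"
    using F by (intro diff_right_mono prod_mono) auto
  also have "\<dots> \<le> exp \<delta> ^ card A - 1"
    using \<delta> by (auto intro!: power_mono)
  also have "\<dots> = exp (real (card A) * \<delta>) - 1" by (simp add: exp_of_nat_mult)
  also have "\<dots> \<le> 2 * (real (card A) * \<delta>)"
  proof -
    \<comment> \<open>\<open>exp y \<le> 1 + y + y\<^sup>2\<close> on \<open>[0, 1]\<close>, where \<open>y\<^sup>2 \<le> y\<close>.\<close>
    define y where "y = real (card A) * \<delta>"
    have y: "0 \<le> y" "y \<le> 1" using small \<delta> by (auto simp: y_def)
    have "exp y \<le> 1 + y + y\<^sup>2" using y by (rule exp_bound)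
    moreover have "y\<^sup>2 \<le> y" using y by (simp add: power2_eq_square mult_left_le)
    ultimately show ?thesis by (simp add: y_def)
  qed
  finally show ?thesis by simp
qed

text \<open>
  Numbers in \<open>[L, 2 ^ m L]\<close> have logarithms which differ by at most \<open>m ln 2 \<le> m\<close>.
\<close>

lemma abs_ln_quotient_minus_1_le:
  fixes x y L :: real
  assumes L: "L > 1" and x: "L \<le> x" "x \<le> 2 ^ m * L" and y: "L \<le> y" "y \<le> 2 ^ m * L"
  shows "\<bar>ln x / ln y - 1\<bar> \<le> real m / ln L"
proof -
  have ub: "ln z \<le> real m + ln L" "ln L \<le> ln z" if "L \<le> z" "z \<le> 2 ^ m * L" for z
  proof -
    have "ln z \<le> ln (2 ^ m * L)" using that L by simp
    also have "\<dots> = real m * ln 2 + ln L" using L by (simp add: ln_mult ln_realpow)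
    also have "\<dots> \<le> real m * 1 + ln L"
      using ln_2_less_1 by (intro add_right_mono mult_left_mono) auto
    finally show "ln z \<le> real m + ln L" by simp
    show "ln L \<le> ln z" using that L by simp
  qed
  have lnL: "ln L > 0" using L by simp
  have lny: "ln L \<le> ln y" using ub y by simp
  have "\<bar>ln x / ln y - 1\<bar> = \<bar>ln x - ln y\<bar> / ln y" using lnL lny by (simp add: field_simps)
  also have "\<dots> \<le> real m / ln y"
    using ub[OF x] ub[OF y] lnL lny by (intro divide_right_mono) auto
  also have "\<dots> \<le> real m / ln L" using lnL lny by (intro divide_left_mono) auto
  finally show ?thesis .
qed

lemma abs_perturbed_quotient_minus_1_le:
  fixes a b q :: real
  assumes a: "\<bar>a\<bar> \<le> u" and b: "\<bar>b\<bar> \<le> u" and q: "\<bar>q - 1\<bar> \<le> v" and u: "u \<le> 1/2" and v: "v \<le> 1"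
  shows "\<bar>(1 + a) / (1 + b) * q - 1\<bar> \<le> 2 * (3 * u + v)"
proof -
  have b2: "1 + b \<ge> 1/2" using b u by linarith
  have aq: "\<bar>a * (q - 1)\<bar> \<le> u * 1"
    unfolding abs_mult using a q v by (intro mult_mono) auto
  have "\<bar>(1 + a) / (1 + b) * q - 1\<bar> = \<bar>a + (q - 1) + a * (q - 1) - b\<bar> / (1 + b)"
  proof -
    have "(1 + a) / (1 + b) * q - 1 = (a + (q - 1) + a * (q - 1) - b) / (1 + b)"
      using b2 by (simp add: field_simps)
    then show ?thesis using b2 by (simp add: abs_divide)
  qed
  also have "\<dots> \<le> (3 * u + v) / (1 + b)"
    using a b q aq b2 by (intro divide_right_mono) linarith+
  also have "\<dots> \<le> (3 * u + v) / (1/2)"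
    using a q b2 by (intro divide_left_mono) auto
  finally show ?thesis by simp
qed

text \<open>On \<open>[e, \<infinity>)\<close> the function \<open>ln x / x\<close> decreases; it is applied here to \<open>x = ln t\<close>.\<close>

lemma ln_ln_over_ln_decreasing:
  fixes L t :: real
  assumes L: "L > 0" "ln L \<ge> exp 1" and t: "t \<ge> L"
  shows "ln (ln t) / ln t \<le> ln (ln L) / ln L"
proof (rule ln_x_over_x_mono)
  show "exp 1 \<le> ln L" by fact
  show "ln L \<le> ln t" using assms by simp
qed


section \<open>The quotient of the two mean-value identities\<close>

lemma integral_powr_shifted:
  fixes L U \<Delta> :: real
  assumes "U > 0" "\<Delta> > 0"
  shows "integral {L..L + U} (\<lambda>t. (t - L) powr \<Delta>) = U powr (\<Delta> + 1) / (\<Delta> + 1)"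
proof -
  have "((\<lambda>t. t powr \<Delta>) has_integral U powr (\<Delta> + 1) / (\<Delta> + 1)) (cbox 0 U)"
    using has_integral_powr_from_0[of \<Delta> U] assms by simp
  from has_integral_affinity[OF this, of 1 "- L"]
  have "((\<lambda>t. (t - L) powr \<Delta>) has_integral U powr (\<Delta> + 1) / (\<Delta> + 1)) {L..L + U}"
    by (simp add: image_affinity_atLeastAtMost add.commute)
  then show ?thesis by (rule integral_unique)
qed

lemma mean_value_quotient:
  fixes L U \<Delta> W \<alpha>0 P Q :: real
  assumes U: "U > 0" and \<Delta>: "\<Delta> > 0" and \<alpha>0: "\<alpha>0 > L"
    and P: "integral {L..L + U} (\<lambda>t. (t - L) powr \<Delta>) = W * (\<alpha>0 - L) powr \<Delta> * P"
    and Q: "U = W * Q"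
  shows "P / Q = 1 / (\<Delta> + 1) * (U / (\<alpha>0 - L)) powr \<Delta>"
proof -
  have W: "W \<noteq> 0" "Q \<noteq> 0" using Q U by auto
  have A: "(\<alpha>0 - L) powr \<Delta> > 0" using \<alpha>0 by simp
  have "U powr \<Delta> * (W * Q) / (\<Delta> + 1) = W * (\<alpha>0 - L) powr \<Delta> * P"
    using P integral_powr_shifted[OF U \<Delta>, of L] U by (simp add: powr_add Q[symmetric])
  then have "W * (U powr \<Delta> * Q) = W * ((\<Delta> + 1) * (\<alpha>0 - L) powr \<Delta> * P)"
    using \<Delta> by (simp add: field_simps)
  then have "U powr \<Delta> * Q = (\<Delta> + 1) * (\<alpha>0 - L) powr \<Delta> * P"
    using W(1) by (rule mult_left_cancel[THEN iffD1, rotated])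
  moreover have "(\<Delta> + 1) * (\<alpha>0 - L) powr \<Delta> \<noteq> 0" using \<Delta> A by simp
  ultimately have "P = U powr \<Delta> * Q / ((\<Delta> + 1) * (\<alpha>0 - L) powr \<Delta>)"
    by (metis nonzero_mult_div_cancel_left)
  then have "P / Q = 1 / (\<Delta> + 1) * (U powr \<Delta> / (\<alpha>0 - L) powr \<Delta>)"
    using W(2) by simp
  then show ?thesis using U \<alpha>0 by (simp add: powr_divide)
qed

text \<open>
  A zero of zeta at \<open>y\<close> causes no exception: it makes \<open>D y\<close> vanish, and both sides
  agree by the convention \<open>x / 0 = 0\<close>.
\<close>

lemma cmod_zeta_quotient:
  assumes x: "D x = (cmod (zeta_crit x))\<^sup>2 / ((1 + \<epsilon> x) * ln x)" "1 + \<epsilon> x > 0" "x > 1"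
    and y: "D y = (cmod (zeta_crit y))\<^sup>2 / ((1 + \<epsilon> y) * ln y)" "1 + \<epsilon> y > 0" "y > 1"
  shows "(cmod (zeta_crit x / zeta_crit y))\<^sup>2 =
    D x / D y * ((1 + \<epsilon> x) / (1 + \<epsilon> y) * (ln x / ln y))"
proof -
  have "(cmod (zeta_crit x))\<^sup>2 = D x * ((1 + \<epsilon> x) * ln x)" "(cmod (zeta_crit y))\<^sup>2 = D y * ((1 + \<epsilon> y) * ln y)"
    using x y by auto
  then show ?thesis by (simp add: norm_divide power_divide)
qed


section \<open>The transformation\<close>

theorem theorem2:
  fixes \<mu> \<phi>1 :: "real \<Rightarrow> real" and y0 T0 \<Delta> :: real and k0 :: nat
  assumes adm: "admissible y0 \<mu>"
    and ladder: "jacobs_ladder y0 \<mu> T0 \<phi>1"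
    and C1: "\<phi>1 C1_differentiable_on {T0<..}"
    and mono: "strict_mono_on {T0<..} \<phi>1"
    and lim: "filterlim \<phi>1 at_top at_top"
    and asymp: "(\<lambda>t. t - \<phi>1 t) \<sim>[at_top] (\<lambda>t. (1 - euler_mascheroni) * t / ln t)"
    and deriv_asymp: "\<exists>\<epsilon>. \<epsilon> \<in> O[at_top](\<lambda>t. ln (ln t) / ln t) \<and>
           (\<forall>\<^sub>F t in at_top. deriv \<phi>1 t = (cmod (zeta_crit t))\<^sup>2 / ((1 + \<epsilon> t) * ln t))"
    and Delta: "\<Delta> > 0"
  shows "\<exists>C. \<forall>k\<in>{1..k0}. \<forall>a :: nat \<Rightarrow> real. (\<forall>L. a L \<in> {0<..1/2}) \<longrightarrow>
           (\<exists>L0>0. \<forall>L::nat. real L > L0 \<longrightarrow>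
              ZQ2_transformation C T0 \<phi>1 k (real L) (a L) (\<lambda>t. (t - real L) powr \<Delta>)
                (\<lambda>U \<alpha>0. 1 / (\<Delta> + 1) * (U / (\<alpha>0 - real L)) powr \<Delta>))"
proof -
  have cont: "continuous_on {T0<..} \<phi>1"
    using C1 by (rule C1_differentiable_imp_continuous_on)
  obtain \<epsilon> where \<epsilon>: "\<epsilon> \<in> O[at_top](\<lambda>t. ln (ln t) / ln t)"
    and D: "\<forall>\<^sub>F t in at_top. deriv \<phi>1 t = (cmod (zeta_crit t))\<^sup>2 / ((1 + \<epsilon> t) * ln t)"
    using deriv_asymp by blast
  obtain K where K: "K > 0"
    and \<epsilon>_bound: "\<forall>\<^sub>F t in at_top. \<bar>\<epsilon> t\<bar> \<le> K * \<bar>ln (ln t) / ln t\<bar>"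
    using landau_o.bigE[OF \<epsilon>] by auto
  define M where "M = 2 * (3 * K + real (k0 + 1))"
  have M: "M > 0" using K by (simp add: M_def add_pos_pos)
  have "\<forall>\<^sub>F t in at_top. K * (ln (ln t) / ln t) \<le> 1/2 \<and>
      real (k0 + 1) * (ln (ln t) / ln t) \<le> 1 \<and> real k0 * (M * (ln (ln t) / ln t)) \<le> 1"
  proof -
    have "\<forall>\<^sub>F t in at_top. c * (ln (ln t) / ln t) < e" if "e > 0" for c e :: real
    proof -
      have "((\<lambda>t::real. c * (ln (ln t) / ln t)) \<longlongrightarrow> 0) at_top" by real_asymp
      then show ?thesis using that by (rule order_tendstoD(2))
    qed
    from this[of "1/2" K, simplified] this[of 1 "real (k0 + 1)", OF zero_less_one]
      this[of 1 "real k0 * M", OF zero_less_one]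
    show ?thesis by eventually_elim (simp add: mult.assoc)
  qed
  moreover have "\<forall>\<^sub>F t::real in at_top. ln t \<ge> exp 1" by real_asymp
  ultimately have "\<forall>\<^sub>F t in at_top. (t / 2 \<le> \<phi>1 t \<and> \<phi>1 t < t) \<and>
      deriv \<phi>1 t = (cmod (zeta_crit t))\<^sup>2 / ((1 + \<epsilon> t) * ln t) \<and>
      \<bar>\<epsilon> t\<bar> \<le> K * \<bar>ln (ln t) / ln t\<bar> \<and> ln t \<ge> exp 1 \<and>
      K * (ln (ln t) / ln t) \<le> 1/2 \<and> real (k0 + 1) * (ln (ln t) / ln t) \<le> 1 \<and>
      real k0 * (M * (ln (ln t) / ln t)) \<le> 1"
    using eventually_between_half_and_self[OF asymp] D \<epsilon>_bound by eventually_elim auto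
  then obtain X0 where X0: "\<And>t. t \<ge> X0 \<Longrightarrow> (t / 2 \<le> \<phi>1 t \<and> \<phi>1 t < t) \<and>
      deriv \<phi>1 t = (cmod (zeta_crit t))\<^sup>2 / ((1 + \<epsilon> t) * ln t) \<and>
      \<bar>\<epsilon> t\<bar> \<le> K * \<bar>ln (ln t) / ln t\<bar> \<and> ln t \<ge> exp 1 \<and>
      K * (ln (ln t) / ln t) \<le> 1/2 \<and> real (k0 + 1) * (ln (ln t) / ln t) \<le> 1 \<and>
      real k0 * (M * (ln (ln t) / ln t)) \<le> 1"
    unfolding eventually_at_top_linorder by blast
  define X where "X = Max {X0, T0 + 1, 2}"
  have X: "X \<ge> X0" "X > T0" "X \<ge> 2" by (auto simp: X_def)
  then have X_nonneg: "X \<ge> 0" by simp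
  have bounds: "t / 2 \<le> \<phi>1 t \<and> \<phi>1 t < t" if "t \<ge> X" for t
    using X0[of t] that X by simp
  define x where "x = (\<lambda>t::real. ln (ln t) / ln t)"
  have main: "ZQ2_transformation (2 * real k0 * M) T0 \<phi>1 k (real L) aL
      (\<lambda>t. (t - real L) powr \<Delta>) (\<lambda>U \<alpha>0. 1 / (\<Delta> + 1) * (U / (\<alpha>0 - real L)) powr \<Delta>)"
    if k: "k \<in> {1..k0}" and aL: "aL \<in> {0<..1/2}" and L: "real L > X" for k aL L
    unfolding ZQ2_transformation_def
  proof (intro ballI allI impI)
    fix U \<alpha> \<beta>
    assume "U \<in> {0<..<aL}"
    then have U: "U > 0" "U \<le> 1" using aL by auto
    let ?L = "real L"
    assume \<alpha>: "associated_points T0 \<phi>1 ?L U k (\<lambda>t. (t - ?L) powr \<Delta>) \<alpha>"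
      and \<beta>: "associated_points_one T0 \<phi>1 ?L U k \<beta>"
    define W where "W = rev_iterate T0 \<phi>1 k (?L + U) - rev_iterate T0 \<phi>1 k ?L"
    obtain d where d: "d \<in> {rev_iterate T0 \<phi>1 k ?L <..< rev_iterate T0 \<phi>1 k (?L + U)}"
      and \<alpha>_d: "\<And>r. r \<le> k \<Longrightarrow> \<alpha> r = (\<phi>1 ^^ (k - r)) d"
      and \<alpha>_int: "integral {?L..?L + U} (\<lambda>t. (t - ?L) powr \<Delta>) =
        W * (\<alpha> 0 - ?L) powr \<Delta> * (\<Prod>r=1..k. deriv \<phi>1 (\<alpha> r))"
      using \<alpha> unfolding associated_points_def W_def by auto
    obtain e where e: "e \<in> {rev_iterate T0 \<phi>1 k ?L <..< rev_iterate T0 \<phi>1 k (?L + U)}"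
      and \<beta>_e: "\<And>r. r \<in> {1..k} \<Longrightarrow> \<beta> r = (\<phi>1 ^^ (k - r)) e"
      and \<beta>_int: "U = W * (\<Prod>r=1..k. deriv \<phi>1 (\<beta> r))"
      using \<beta> unfolding associated_points_one_def W_def by auto
    have LX: "?L \<ge> X" "?L + U \<ge> X" using L U by auto
    have \<alpha>0: "\<alpha> 0 \<in> {?L<..<?L + U}"
      using funpow_between_rev_iterates[OF cont mono lim X(2) X_nonneg bounds LX d, of k] \<alpha>_d[of 0]
      by (simp add: rev_iterate_def)
    define F where "F = (\<lambda>r. (1 + \<epsilon> (\<alpha> r)) / (1 + \<epsilon> (\<beta> r)) * (ln (\<alpha> r) / ln (\<beta> r)))"
    have lnL: "ln ?L \<ge> exp 1" using X0[of ?L] L X by simp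
    have x_L: "x ?L \<ge> 1 / ln ?L"
    proof -
      have "ln (exp 1) \<le> ln (ln ?L)"
        using lnL less_le_trans[OF exp_gt_zero lnL] by (subst ln_le_cancel_iff) auto
      then have "1 \<le> ln (ln ?L)" by simp
      then show ?thesis
        using less_le_trans[OF exp_gt_zero lnL] by (simp add: x_def divide_right_mono)
    qed
    have x_pos: "x ?L > 0"
      using x_L less_le_trans[OF exp_gt_zero lnL] by (meson divide_pos_pos less_le_trans zero_less_one)
    have small: "K * x ?L \<le> 1/2" "real (k0 + 1) * x ?L \<le> 1" "real k0 * (M * x ?L) \<le> 1"
      using X0[of ?L] L X by (auto simp: x_def)
    have point: "deriv \<phi>1 t = (cmod (zeta_crit t))\<^sup>2 / ((1 + \<epsilon> t) * ln t)"
      "\<bar>\<epsilon> t\<bar> \<le> K * x ?L" "t > 1" "1 + \<epsilon> t > 0" if t: "t \<ge> ?L" for t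
    proof -
      have tX: "t \<ge> X0" using t L X by simp
      show "deriv \<phi>1 t = (cmod (zeta_crit t))\<^sup>2 / ((1 + \<epsilon> t) * ln t)" using X0[OF tX] by simp
      show "t > 1" using t L X by simp
      have lnt: "ln t \<ge> exp 1" using X0[OF tX] by simp
      then have "ln t \<ge> 1" using exp_ge_add_one_self[of 1] by linarith
      then have "\<bar>ln (ln t) / ln t\<bar> = x t" by (simp add: x_def)
      then have "\<bar>\<epsilon> t\<bar> \<le> K * x t" using X0[OF tX] by simp
      also have "\<dots> \<le> K * x ?L"
        unfolding x_def using ln_ln_over_ln_decreasing[OF _ lnL t] L X K
        by (intro mult_left_mono) auto
      finally show "\<bar>\<epsilon> t\<bar> \<le> K * x ?L" .
      then show "1 + \<epsilon> t > 0" using small(1) by linarith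
    qed
    have range: "?L \<le> (\<phi>1 ^^ (k - r)) c \<and> (\<phi>1 ^^ (k - r)) c \<le> 2 ^ (k0 + 1) * ?L"
      if c: "c \<in> {rev_iterate T0 \<phi>1 k ?L <..< rev_iterate T0 \<phi>1 k (?L + U)}" for c r
    proof -
      note fb = funpow_bounds[OF cont mono lim X(2) X_nonneg bounds LX c, of "k - r"]
      \<comment> \<open>One more factor 2 absorbs the summand \<open>U\<close>.\<close>
      have "(2::real) ^ k * (?L + U) \<le> 2 ^ k0 * (2 * ?L)"
        using k U L X by (intro mult_mono power_increasing) auto
      then show ?thesis using fb by simp
    qed
    have \<alpha>_range: "?L \<le> \<alpha> r" "\<alpha> r \<le> 2 ^ (k0 + 1) * ?L"
      and \<beta>_range: "?L \<le> \<beta> r" "\<beta> r \<le> 2 ^ (k0 + 1) * ?L" if "r \<in> {1..k}" for r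
      using range[OF d, of r] range[OF e, of r] \<alpha>_d[of r] \<beta>_e[of r] that by auto
    have F_bound: "\<bar>F r - 1\<bar> \<le> M * x ?L" if r: "r \<in> {1..k}" for r
    proof -
      have "\<bar>ln (\<alpha> r) / ln (\<beta> r) - 1\<bar> \<le> real (k0 + 1) / ln ?L"
        using abs_ln_quotient_minus_1_le[OF _ \<alpha>_range[OF r] \<beta>_range[OF r]] L X by simp
      also have "\<dots> \<le> real (k0 + 1) * x ?L"
        using mult_left_mono[OF x_L, of "real (k0 + 1)"] by simp
      finally have "\<bar>F r - 1\<bar> \<le> 2 * (3 * (K * x ?L) + real (k0 + 1) * x ?L)"
        unfolding F_def
        by (intro abs_perturbed_quotient_minus_1_le point(2) \<alpha>_range[OF r] \<beta>_range[OF r] small)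
      then show ?thesis by (simp add: M_def algebra_simps)
    qed
    have "real k * (M * x ?L) \<le> real k0 * (M * x ?L)"
      using k M x_pos by (intro mult_right_mono) auto
    then have "real (card {1..k}) * (M * x ?L) \<le> 1" using small(3) by simp
    from abs_prod_minus_1_le[OF F_bound this]
    have "\<bar>(\<Prod>r=1..k. F r) - 1\<bar> \<le> 2 * real k * (M * x ?L)" using M x_pos by simp
    also have "\<dots> \<le> 2 * real k0 * (M * x ?L)"
      using k M x_pos by (intro mult_right_mono) auto
    finally have error: "\<bar>(\<Prod>r=1..k. F r) - 1\<bar> \<le> 2 * real k0 * M * (ln (ln ?L) / ln ?L)"
      by (simp add: x_def)
    have "(\<Prod>r=1..k. (cmod (zeta_crit (\<alpha> r) / zeta_crit (\<beta> r)))\<^sup>2) =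
        (\<Prod>r=1..k. deriv \<phi>1 (\<alpha> r) / deriv \<phi>1 (\<beta> r) * F r)"
    proof (rule prod.cong[OF refl])
      fix r assume "r \<in> {1..k}"
      note pt = point[OF \<alpha>_range(1)[OF this]] point[OF \<beta>_range(1)[OF this]]
      show "(cmod (zeta_crit (\<alpha> r) / zeta_crit (\<beta> r)))\<^sup>2 =
          deriv \<phi>1 (\<alpha> r) / deriv \<phi>1 (\<beta> r) * F r"
        unfolding F_def by (rule cmod_zeta_quotient) (fact pt)+
    qed
    also have "\<dots> = (\<Prod>r=1..k. F r) *
        ((\<Prod>r=1..k. deriv \<phi>1 (\<alpha> r)) / (\<Prod>r=1..k. deriv \<phi>1 (\<beta> r)))"
      by (simp add: prod.distrib prod_dividef)
    also have "\<dots> = (\<Prod>r=1..k. F r) * (1 / (\<Delta> + 1) * (U / (\<alpha> 0 - ?L)) powr \<Delta>)"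
      using mean_value_quotient[OF U(1) Delta _ \<alpha>_int \<beta>_int] \<alpha>0 by simp
    finally show "\<alpha> 0 \<in> {?L<..<?L + U} \<and>
        (\<exists>\<theta>. \<bar>\<theta>\<bar> \<le> 2 * real k0 * M * (ln (ln ?L) / ln ?L) \<and>
          (\<Prod>r=1..k. (cmod (zeta_crit (\<alpha> r) / zeta_crit (\<beta> r)))\<^sup>2) =
            (1 + \<theta>) * (1 / (\<Delta> + 1) * (U / (\<alpha> 0 - ?L)) powr \<Delta>))"
      using \<alpha>0 error by (intro conjI exI[of _ "(\<Prod>r=1..k. F r) - 1"]) auto
  qed
  show ?thesis
  proof (rule exI[of _ "2 * real k0 * M"], intro ballI allI impI)
    fix k a assume "k \<in> {1..k0}" "\<forall>L::nat. a L \<in> {0<..1/2::real}"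
    then show "\<exists>L0>0. \<forall>L::nat. real L > L0 \<longrightarrow>
        ZQ2_transformation (2 * real k0 * M) T0 \<phi>1 k (real L) (a L) (\<lambda>t. (t - real L) powr \<Delta>)
          (\<lambda>U \<alpha>0. 1 / (\<Delta> + 1) * (U / (\<alpha>0 - real L)) powr \<Delta>)"
      using main X by (intro exI[of _ X]) auto
  qed
qed

end
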